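(* Let $E \subset \mathbb{T}$ be a closed set of measure $0$. Let $g \in H^2$ be non-vanishing on $\mathbb{D}$, and let $f \in C(E)$ be non-vanishing on $E$. Then there exists a sequence of polynomials $P_n$ which do not vanish on the closed unit disc $\overline{\mathbb{D}}$ such that $P_n \to g$ in $H^2$ and $P_n \to f$ uniformly on $E$.
   Context: $\mathbb{D}$ is the open unit disc, $\mathbb{T}$ the unit circle with arc-length measure. $H^2$ is the Hardy space of holomorphic functions $\sum_k a_kz^k$ on $\mathbb{D}$ with norm $\|f\|_{H^2}^2=\sum_k|a_k|^2$. $C(E)$ is the space of continuous functions on $E$ with the sup norm. *)

theory Defs
  imports "HOL-Analysis.Analysis" "HOL-Computational_Algebra.Polynomial"
begin

definition h2_coeff :: "(complex \<Rightarrow> complex) \<Rightarrow> nat \<Rightarrow> complex" where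
  "h2_coeff g k = (deriv ^^ k) g 0 / of_nat (fact k)"

definition H2 :: "(complex \<Rightarrow> complex) set" where
  "H2 = {g. g holomorphic_on ball 0 1 \<and> summable (\<lambda>k. (cmod (h2_coeff g k))^2)}"

definition h2_dist :: "(complex \<Rightarrow> complex) \<Rightarrow> (complex \<Rightarrow> complex) \<Rightarrow> real" where
  "h2_dist f g = sqrt (\<Sum>k. (cmod (h2_coeff f k - h2_coeff g k))^2)"

definition circle_null :: "complex set \<Rightarrow> bool" where
  "circle_null E \<longleftrightarrow> {t \<in> {0..<2*pi}. cis t \<in> E} \<in> null_sets lborel"

end

theory Submission
  imports Defs "HOL-Complex_Analysis.Complex_Analysis"
begin

text \<open>
  Replacing $g$ by a dilation $g(r\,\cdot)$ and taking logarithms ($E$ does not separate the plane,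
  so $f = e^F$ on $E$), one may write $g = e^G$ with $G$ holomorphic near the closed disc. It
  suffices to correct $G$ by some $\varphi$ that is close to $F - G$ on $E$, bounded on the disc and
  small in $H^2$; then a Taylor polynomial of $e^{G + \varphi}$ does the job.

  Such a $\varphi$ is a product $p\psi$. Covering $E$ by finitely many discs of small total radius
  and adding up Poisson kernels gives $H$ holomorphic near the closed disc with $\Re H \ge 0$,
  $\Re H$ large on $E$ and $H(0)$ small. Then $\psi = H / (1 + H)$ is close to $1$ on $E$, and
  $|\psi|^2 \le \Re\psi$ yields $\|\psi\|_{H^2}^2 \le \Re\psi(0)$, which is small. The same peak
  functions show that $\bar z = 1/z$ is approximable on $E$ by
  $(\psi(z) - \psi(0)) / (z (1 - \psi(0)))$, so by Stone-Weierstrass every continuous function on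
  $E$ is uniformly approximable there by functions $p$ holomorphic near the closed disc.
\<close>

section \<open>Parseval on the circle\<close>

definition taylor_poly :: "(complex \<Rightarrow> complex) \<Rightarrow> nat \<Rightarrow> complex poly" where
  "taylor_poly F n = (\<Sum>k<n. monom (h2_coeff F k) k)"

lemma poly_taylor_poly: "poly (taylor_poly F n) z = (\<Sum>k<n. h2_coeff F k * z ^ k)"
  by (simp add: taylor_poly_def poly_sum poly_monom)

lemma h2_coeff_0 [simp]: "h2_coeff F 0 = F 0"
  by (simp add: h2_coeff_def)

lemma h2_coeff_sums:
  assumes "F holomorphic_on ball 0 R" "cmod z < R"
  shows "(\<lambda>k. h2_coeff F k * z ^ k) sums F z"
  using holomorphic_power_series[of F 0 R z] assms by (simp add: h2_coeff_def)

lemma h2_coeff_diff: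
  assumes "F holomorphic_on ball 0 R" "G holomorphic_on ball 0 R" "R > 0"
  shows "h2_coeff (\<lambda>z. F z - G z) k = h2_coeff F k - h2_coeff G k"
  using higher_deriv_diff[OF assms(1,2), of 0 k] assms(3) by (simp add: h2_coeff_def diff_divide_distrib)

text \<open>Convergence at a radius \<open>s\<close> strictly between 1 and \<open>R\<close> makes
  the coefficients absolutely summable, and the M-test then applies on the closed disc.\<close>

lemma uniform_limit_taylor_poly:
  assumes F: "F holomorphic_on ball 0 R" and R: "R > 1"
  shows "uniform_limit (cball 0 1) (\<lambda>n. poly (taylor_poly F n)) F sequentially"
proof -
  obtain s where s: "1 < s" "s < R" using dense R by blast
  have "summable (\<lambda>k. h2_coeff F k * of_real s ^ k)"
    using h2_coeff_sums[OF F, of "of_real s"] s by (auto simp: sums_iff)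
  then have sm: "summable (\<lambda>k. cmod (h2_coeff F k))"
    using powser_insidea[of "h2_coeff F" "of_real s" 1] s by simp
  have "uniform_limit (cball 0 1) (\<lambda>n z. \<Sum>k<n. h2_coeff F k * z ^ k)
          (\<lambda>z. \<Sum>k. h2_coeff F k * z ^ k) sequentially"
    by (rule Weierstrass_m_test[OF _ sm])
       (auto simp: norm_mult norm_power intro!: mult_left_le power_le_one)
  moreover have "(\<Sum>k. h2_coeff F k * z ^ k) = F z" if "z \<in> cball 0 1" for z
    using h2_coeff_sums[OF F, of z] R that by (simp add: sums_iff)
  ultimately show ?thesis
    using uniform_limit_cong'[of "cball 0 1" "\<lambda>n z. \<Sum>k<n. h2_coeff F k * z ^ k"
        "\<lambda>n. poly (taylor_poly F n)" "\<lambda>z. \<Sum>k. h2_coeff F k * z ^ k" F sequentially]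
    by (simp only: poly_taylor_poly)
qed

section \<open>Orthogonality, mean value property and Parseval's identity\<close>

lemma has_integral_cis_int:
  "((\<lambda>t. cis (of_int m * t)) has_integral (if m = 0 then of_real (2 * pi) else 0)) {0..2*pi}"
proof (cases "m = 0")
  case True
  then show ?thesis
    using has_integral_const_real[of "1::complex" 0 "2*pi"] by (simp add: scaleR_conv_of_real)
next
  case False
  have "((\<lambda>t. cis (of_int m * t) / (\<i> * of_int m)) has_vector_derivative cis (of_int m * t))
          (at t within {0..2*pi})" for t
  proof -
    have "((\<lambda>w. exp (\<i> * of_int m * w) / (\<i> * of_int m)) has_field_derivative
        exp (\<i> * of_int m * of_real t)) (at (of_real t))"
      by (rule derivative_eq_intros refl | use False in simp)+
    from has_vector_derivative_real_field[OF this] show ?thesis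
      by (simp add: cis_conv_exp mult.assoc)
  qed
  then have "((\<lambda>t. cis (of_int m * t)) has_integral
      (cis (of_int m * (2*pi)) / (\<i> * of_int m) - cis (of_int m * 0) / (\<i> * of_int m))) {0..2*pi}"
    by (intro fundamental_theorem_of_calculus) auto
  moreover have "cis (of_int m * (2*pi)) = 1"
    by (metis cis_multiple_2pi Ints_of_int mult.commute)
  ultimately show ?thesis using False by simp
qed

lemma has_integral_poly_cis:
  "((\<lambda>t. \<Sum>k<n. a k * cis t ^ k) has_integral (if n = 0 then 0 else of_real (2 * pi) * a 0)) {0..2*pi}"
proof -
  have "((\<lambda>t. \<Sum>k<n. a k * cis (of_int (int k) * t)) has_integral
      (\<Sum>k<n. a k * (if int k = 0 then of_real (2 * pi) else 0))) {0..2*pi}"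
    by (intro has_integral_sum finite_lessThan has_integral_mult_right has_integral_cis_int)
  moreover have "(\<Sum>k<n. a k * (if int k = 0 then of_real (2 * pi) else 0)) =
      (\<Sum>k<n. (if k = 0 then of_real (2 * pi) * a k else 0))"
    by (intro sum.cong) auto
  ultimately show ?thesis
    by (simp add: Complex.DeMoivre if_distrib sum.delta mult.commute cong: if_cong split: if_splits)
qed

lemma has_integral_cmod_square_poly_cis:
  "((\<lambda>t. (cmod (\<Sum>k<n. a k * cis t ^ k))\<^sup>2) has_integral 2 * pi * (\<Sum>k<n. (cmod (a k))\<^sup>2)) {0..2*pi}"
proof -
  \<comment> \<open>Conjugation turns \<open>cis t ^ k\<close> into frequency \<open>-k\<close>,
    hence the integer frequencies. After integration only the diagonal \<open>j = k\<close>
    survives.\<close>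
  have eq: "(\<Sum>j<n. \<Sum>k<n. a j * cnj (a k) * cis (of_int (int j - int k) * t)) =
      of_real ((cmod (\<Sum>k<n. a k * cis t ^ k))\<^sup>2)" for t
    unfolding complex_norm_square cnj_sum sum_product
    by (intro sum.cong refl) (simp add: Complex.DeMoivre cis_cnj cis_mult algebra_simps)
  have "((\<lambda>t. \<Sum>j<n. \<Sum>k<n. a j * cnj (a k) * cis (of_int (int j - int k) * t)) has_integral
     (\<Sum>j<n. \<Sum>k<n. a j * cnj (a k) * (if int j - int k = 0 then of_real (2 * pi) else 0))) {0..2*pi}"
    by (intro has_integral_sum finite_lessThan has_integral_mult_right has_integral_cis_int)
  moreover have "(\<Sum>j<n. \<Sum>k<n. a j * cnj (a k) * (if int j - int k = 0 then of_real (2 * pi) else 0)) =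
      of_real (2 * pi * (\<Sum>k<n. (cmod (a k))\<^sup>2))"
    by (simp add: if_distrib sum.delta complex_norm_square[simplified] sum_distrib_left mult_ac cong: if_cong)
  ultimately have "((\<lambda>t. complex_of_real ((cmod (\<Sum>k<n. a k * cis t ^ k))\<^sup>2)) has_integral
      of_real (2 * pi * (\<Sum>k<n. (cmod (a k))\<^sup>2))) {0..2*pi}"
    unfolding eq by simp
  from has_integral_linear[OF this bounded_linear_Re] show ?thesis by (simp add: o_def)
qed

lemma uniform_limit_taylor_poly_cis:
  assumes "F holomorphic_on ball 0 R" "R > 1"
  shows "uniform_limit {0..2*pi} (\<lambda>n t. \<Sum>k<n. h2_coeff F k * cis t ^ k) (\<lambda>t. F (cis t)) sequentially"
  using uniform_limit_compose'[OF uniform_limit_taylor_poly[OF assms], of cis "{0..2*pi}"]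
  by (simp add: poly_taylor_poly)

lemma has_integral_holomorphic_cis:
  assumes F: "F holomorphic_on ball 0 R" and R: "R > 1"
  shows "((\<lambda>t. F (cis t)) has_integral of_real (2 * pi) * F 0) {0..2*pi}"
proof -
  obtain I J where I: "\<And>n. ((\<lambda>t. \<Sum>k<n. h2_coeff F k * cis t ^ k) has_integral I n) {0..2*pi}"
    and J: "((\<lambda>t. F (cis t)) has_integral J) {0..2*pi}" and lim: "I \<longlonglongrightarrow> J"
    by (rule uniform_limit_integral[OF uniform_limit_taylor_poly_cis[OF F R]])
       (auto intro!: continuous_intros)
  \<comment> \<open>The empty partial sum at \<open>n = 0\<close> integrates to 0, so the integrals
    are constant only from \<open>n = 1\<close> on.\<close>
  have "I n = of_real (2 * pi) * F 0" if "n > 0" for n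
    using has_integral_unique[OF I has_integral_poly_cis] that by auto
  then have "eventually (\<lambda>n. I n = of_real (2 * pi) * F 0) sequentially"
    by (rule eventually_mono[OF eventually_gt_at_top[of "0::nat"]])
  then have "I \<longlonglongrightarrow> of_real (2 * pi) * F 0" by (rule tendsto_eventually)
  with lim J show ?thesis using LIMSEQ_unique by blast
qed

lemma parseval_cis:
  assumes F: "F holomorphic_on ball 0 R" and R: "R > 1"
  shows "summable (\<lambda>k. (cmod (h2_coeff F k))\<^sup>2)"
    and "((\<lambda>t. (cmod (F (cis t)))\<^sup>2) has_integral 2 * pi * (\<Sum>k. (cmod (h2_coeff F k))\<^sup>2)) {0..2*pi}"
proof -
  \<comment> \<open>Boundedness on the circle keeps the convergence uniform after squaring.\<close>
  have "continuous_on {0..2*pi} (\<lambda>t. F (cis t))"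
    by (rule continuous_on_compose2[OF holomorphic_on_imp_continuous_on[OF F]])
       (use R in \<open>auto intro!: continuous_intros\<close>)
  then have "bounded ((\<lambda>t. F (cis t)) ` {0..2*pi})"
    by (intro compact_imp_bounded compact_continuous_image) auto
  then have bdd: "bounded ((\<lambda>t. cmod (F (cis t))) ` {0..2*pi})"
    unfolding bounded_iff by auto
  note n = uniform_limit_norm[OF uniform_limit_taylor_poly_cis[OF F R]]
  have "uniform_limit {0..2*pi} (\<lambda>n t. (cmod (\<Sum>k<n. h2_coeff F k * cis t ^ k))\<^sup>2)
      (\<lambda>t. (cmod (F (cis t)))\<^sup>2) sequentially"
    unfolding power2_eq_square by (intro uniform_lim_mult n bdd)
  then obtain I J where
    I: "\<And>n. ((\<lambda>t. (cmod (\<Sum>k<n. h2_coeff F k * cis t ^ k))\<^sup>2) has_integral I n) {0..2*pi}"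
    and J: "((\<lambda>t. (cmod (F (cis t)))\<^sup>2) has_integral J) {0..2*pi}" and lim: "I \<longlonglongrightarrow> J"
    by (rule uniform_limit_integral) (auto intro!: continuous_intros)
  have "I = (\<lambda>n. 2 * pi * (\<Sum>k<n. (cmod (h2_coeff F k))\<^sup>2))"
    using has_integral_unique[OF I has_integral_cmod_square_poly_cis] by auto
  with lim have "(\<lambda>n. (2 * pi * (\<Sum>k<n. (cmod (h2_coeff F k))\<^sup>2)) / (2*pi)) \<longlonglongrightarrow> J / (2*pi)"
    by (intro tendsto_divide) auto
  then have "(\<lambda>k. (cmod (h2_coeff F k))\<^sup>2) sums (J / (2*pi))"
    by (simp add: sums_def)
  then show "summable (\<lambda>k. (cmod (h2_coeff F k))\<^sup>2)"
    and "((\<lambda>t. (cmod (F (cis t)))\<^sup>2) has_integral 2 * pi * (\<Sum>k. (cmod (h2_coeff F k))\<^sup>2)) {0..2*pi}"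
    using J by (auto simp: sums_iff)
qed

text \<open>On the circle |F|^2 <= K^2 |\<psi>|^2 <= K^2 Re \<psi>, and the mean of Re \<psi> is its
  value at the origin. Control of a mean square is thus reduced to control at one point.\<close>

lemma suminf_h2_coeff_le:
  assumes F: "F holomorphic_on ball 0 R" and psi: "\<psi> holomorphic_on ball 0 R" and R: "R > 1"
    and le: "\<And>z. cmod z = 1 \<Longrightarrow> cmod (F z) \<le> K * cmod (\<psi> z)"
    and Re: "\<And>z. cmod z = 1 \<Longrightarrow> (cmod (\<psi> z))\<^sup>2 \<le> Re (\<psi> z)"
  shows "(\<Sum>k. (cmod (h2_coeff F k))\<^sup>2) \<le> K\<^sup>2 * Re (\<psi> 0)"
proof -
  have "((\<lambda>t. Re (\<psi> (cis t))) has_integral 2 * pi * Re (\<psi> 0)) {0..2*pi}"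
    using has_integral_linear[OF has_integral_holomorphic_cis[OF psi R] bounded_linear_Re]
    by (simp add: o_def)
  then have "((\<lambda>t. K\<^sup>2 * Re (\<psi> (cis t))) has_integral K\<^sup>2 * (2 * pi * Re (\<psi> 0))) {0..2*pi}"
    by (rule has_integral_mult_right)
  moreover have "(cmod (F (cis t)))\<^sup>2 \<le> K\<^sup>2 * Re (\<psi> (cis t))" for t
  proof -
    have "(cmod (F (cis t)))\<^sup>2 \<le> (K * cmod (\<psi> (cis t)))\<^sup>2"
      using le[of "cis t"] by (intro power_mono) auto
    also have "\<dots> \<le> K\<^sup>2 * Re (\<psi> (cis t))"
      using Re[of "cis t"] by (simp add: power_mult_distrib mult_left_mono)
    finally show ?thesis .
  qed
  ultimately have "2 * pi * (\<Sum>k. (cmod (h2_coeff F k))\<^sup>2) \<le> K\<^sup>2 * (2 * pi * Re (\<psi> 0))"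
    by (intro has_integral_le[OF parseval_cis(2)[OF F R]])
  then have "(2 * pi) * (\<Sum>k. (cmod (h2_coeff F k))\<^sup>2) \<le> (2 * pi) * (K\<^sup>2 * Re (\<psi> 0))"
    by (simp only: mult_ac)
  then show ?thesis by (rule mult_left_le_imp_le) simp
qed

section \<open>Peak functions on null sets\<close>

lemma norm_cis_diff_le: "cmod (cis s - cis t) \<le> \<bar>s - t\<bar>"
proof -
  have "cis s - cis t = cis t * (exp (\<i> * of_real (s - t)) - 1)"
    unfolding cis_conv_exp[symmetric] by (simp add: algebra_simps cis_mult)
  then have "cmod (cis s - cis t) = 2 * \<bar>sin ((s - t) / 2)\<bar>"
    using dist_exp_i_1[of "s - t"] by (simp add: norm_mult)
  also have "\<dots> \<le> \<bar>s - t\<bar>"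
    using abs_sin_x_le_abs_x[of "(s - t) / 2"] by simp
  finally show ?thesis .
qed

text \<open>Outer regularity puts the angles of \<open>E\<close> inside an open set of length below
  \<open>\<delta>\<close>; on a fine enough uniform grid, all cells that meet them lie inside that
  open set. Equal radii let a single dilation factor serve all centres in the peak function.\<close>

lemma circle_null_cover:
  assumes E: "E \<subseteq> sphere 0 1" "closed E" "circle_null E" and d: "\<delta> > 0"
  obtains l :: real and W :: "complex set"
  where "0 < l" "l < 1" "finite W" "W \<subseteq> sphere 0 1" "card W * l \<le> \<delta>"
    "\<And>z. z \<in> E \<Longrightarrow> \<exists>w\<in>W. cmod (z - w) \<le> l"
proof -
  \<comment> \<open>The closed interval makes \<open>K\<close> compact; its extra endpoint
    \<open>2*pi\<close> is a null set.\<close>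
  define K where "K = {0..2*pi} \<inter> cis -` E"
  have "closed (cis -` E)"
    using E(2) by (intro closed_vimage) (auto intro!: continuous_intros)
  then have cK: "compact K" unfolding K_def by (intro compact_Int_closed) auto
  have "{t \<in> {0..<2*pi}. cis t \<in> E} \<union> {2*pi} \<in> null_sets lborel"
    using E(3) by (intro null_sets.Un) (auto simp: circle_null_def)
  then have nK: "K \<in> null_sets lborel"
    by (rule null_sets_subset) (use cK in \<open>auto simp: K_def dest: compact_imp_closed\<close>)
  obtain U where U: "open U" "K \<subseteq> U" "emeasure lborel (U - K) < ennreal \<delta>"
    using outer_regular_lborel[of K \<delta>] cK d compact_imp_closed by (metis borel_closed)
  have mU: "emeasure lborel U < ennreal \<delta>"
    using emeasure_Diff_null_set[OF nK, of U] U by simp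
  obtain e where e: "e > 0" "\<And>x y. x \<in> K \<Longrightarrow> y \<in> -U \<Longrightarrow> e \<le> dist x y"
    using separate_compact_closed[of K "-U"] cK U
    by (metis Diff_disjoint Diff_eq Int_commute closed_Compl disjoint_eq_subset_Compl double_compl)
  \<comment> \<open>The minimum with 1 is what later makes \<open>1 - l\<close> a positive dilation
    factor. With \<open>l = 2 * pi / m\<close> the first \<open>m\<close> cells fill a full turn
    exactly.\<close>
  obtain m :: nat where m: "2 * pi / min e 1 < real m" using reals_Archimedean2 by blast
  have "0 < 2 * pi / min e 1" using e(1) by (intro divide_pos_pos) auto
  then have mpos: "0 < real m" using m by linarith
  define l where "l = 2 * pi / real m"
  have "0 < min e 1" using e(1) by simp
  then have l: "0 < l" "l < min e 1"
    using m mpos unfolding l_def by (simp_all only: pos_divide_less_eq mult.commute) simp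
  \<comment> \<open>Intervals of length l < e meeting K stay inside U, so their number is controlled by the measure of U.\<close>
  define J where "J = {j. j < m \<and> {real j * l..<real (Suc j) * l} \<inter> K \<noteq> {}}"
  have fJ: "finite J" unfolding J_def by auto
  have sub: "(\<Union>j\<in>J. {real j * l..<real (Suc j) * l}) \<subseteq> U"
  proof clarify
    fix j y assume "j \<in> J" and y: "y \<in> {real j * l..<real (Suc j) * l}"
    then obtain x where x: "x \<in> K" "x \<in> {real j * l..<real (Suc j) * l}"
      unfolding J_def by blast
    have "dist x y < l" using x y by (auto simp: dist_real_def algebra_simps)
    with e(2)[OF x(1), of y] l show "y \<in> U" by auto
  qed
  have disj: "disjoint_family_on (\<lambda>j. {real j * l..<real (Suc j) * l}) J"
    unfolding disjoint_family_on_def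
  proof (intro ballI impI)
    fix i j :: nat assume "i \<noteq> j"
    then have "Suc i \<le> j \<or> Suc j \<le> i" by linarith
    then have "real (Suc i) * l \<le> real j * l \<or> real (Suc j) * l \<le> real i * l"
      using l(1) by (metis less_imp_le mult_right_mono of_nat_le_iff)
    then show "{real i * l..<real (Suc i) * l} \<inter> {real j * l..<real (Suc j) * l} = {}" by auto
  qed
  have "ennreal (card J * l) = (\<Sum>j\<in>J. emeasure lborel {real j * l..<real (Suc j) * l})"
    using l by (simp add: algebra_simps ennreal_mult flip: ennreal_of_nat_eq_real_of_nat)
  also have "\<dots> = emeasure lborel (\<Union>j\<in>J. {real j * l..<real (Suc j) * l})"
    using fJ disj by (intro sum_emeasure) auto
  also have "\<dots> \<le> emeasure lborel U"
    using sub U(1) by (intro emeasure_mono) auto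
  finally have "ennreal (card J * l) < ennreal \<delta>" using mU by simp
  then have cJ: "card J * l < \<delta>" using l d by (simp add: ennreal_less_iff)
  show ?thesis
  proof
    show "0 < l" "l < 1" using l by auto
    show "finite ((\<lambda>j. cis (real j * l)) ` J)" using fJ by simp
    show "(\<lambda>j. cis (real j * l)) ` J \<subseteq> sphere 0 1" by auto
    have "card ((\<lambda>j. cis (real j * l)) ` J) * l \<le> card J * l"
      using card_image_le[OF fJ] l by (intro mult_right_mono) auto
    with cJ show "card ((\<lambda>j. cis (real j * l)) ` J) * l \<le> \<delta>" by linarith
    fix z assume z: "z \<in> E"
    then have "cmod z = 1" using E(1) by auto
    then obtain t where t: "0 \<le> t" "t < 2 * pi" "z = cis t"
      using complex_unimodular_polar by (metis cis_conv_exp cis.ctr)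
    define j where "j = nat \<lfloor>t / l\<rfloor>"
    have "real j = of_int \<lfloor>t / l\<rfloor>" using t l by (simp add: j_def)
    then have "real j \<le> t / l" "t / l < real j + 1" by linarith+
    then have jt: "real j * l \<le> t" "t < real (Suc j) * l"
      using l by (auto simp: field_simps)
    have "real j * l < real m * l" using jt t mpos by (simp add: l_def)
    then have "j < m" using l by simp
    then have "j \<in> J" using jt t z by (auto simp: J_def K_def)
    moreover have "cmod (z - cis (real j * l)) \<le> l"
      using norm_cis_diff_le[of t "real j * l"] jt t by (auto simp: algebra_simps)
    ultimately show "\<exists>w\<in>(\<lambda>j. cis (real j * l)) ` J. cmod (z - w) \<le> l" by blast
  qed
qed

section \<open>Poisson kernels and peak functions\<close>

text \<open>At \<open>r * cnj a * z\<close> in place of \<open>w\<close>, with |a| = |z| = 1, this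
  is the Poisson kernel. There is no exception at \<open>w = 1\<close>, where division by zero makes
  both sides 0.\<close>

lemma Re_moebius: "Re ((1 + w) / (1 - w)) = (1 - (cmod w)\<^sup>2) / (cmod (1 - w))\<^sup>2"
proof -
  have "Re ((1 + w) / (1 - w)) = Re ((1 + w) * cnj (1 - w)) / (cmod (1 - w))\<^sup>2"
    by (simp add: Re_divide_Reals complex_div_cnj[of "1 + w"])
  also have "Re ((1 + w) * cnj (1 - w)) = 1 - (cmod w)\<^sup>2"
    unfolding cmod_power2 by (simp add: power2_eq_square algebra_simps)
  finally show ?thesis .
qed

text \<open>The map H / (1 + H) sends the right half-plane into the disc |\<psi> - 1/2| <= 1/2,
  which is the condition |\<psi>|^2 <= Re \<psi>; large Re H gives values near 1, small H values
  near 0. A Poisson kernel is at least \<open>1 / (4 * l)\<close> at circle points within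
  \<open>l\<close> of its centre but equals 1 at the origin, so a cover of small total radius makes
  \<open>H\<close> large on \<open>E\<close> and small at 0.\<close>

lemma peak_function:
  assumes E: "E \<subseteq> sphere 0 1" "closed E" "circle_null E" and d: "\<delta> > 0"
  obtains R and \<psi> :: "complex \<Rightarrow> complex"
  where "R > 1" "\<psi> holomorphic_on ball 0 R"
    "\<And>z. cmod z < R \<Longrightarrow> (cmod (\<psi> z))\<^sup>2 \<le> Re (\<psi> z)"
    "\<And>z. z \<in> E \<Longrightarrow> cmod (1 - \<psi> z) \<le> \<delta>" "cmod (\<psi> 0) \<le> \<delta>"
proof -
  \<comment> \<open>The factor \<open>4 / \<delta>\<close> in \<open>H\<close> turns the total
    radius into \<open>H 0\<close>, so a total radius of at most \<delta>^2 / 4 yields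
    \<open>H 0\<close> of modulus at most \<open>\<delta>\<close>.\<close>
  have d2: "\<delta>\<^sup>2 / 4 > 0" using d by simp
  obtain l :: real and W where l: "0 < l" "l < 1" and W: "finite W" "W \<subseteq> sphere 0 1"
    and card: "card W * l \<le> \<delta>\<^sup>2 / 4" and cov: "\<And>z. z \<in> E \<Longrightarrow> \<exists>w\<in>W. cmod (z - w) \<le> l"
    using circle_null_cover[OF E d2] by metis
  define r where "r = 1 - l"
  have r: "0 < r" "r < 1" using l by (auto simp: r_def)
  \<comment> \<open>The real part of h w is the Poisson kernel with pole w / r, just outside the disc.\<close>
  define h where "h = (\<lambda>w z. (1 + of_real r * cnj w * z) / (1 - of_real r * cnj w * z))"
  \<comment> \<open>Every point of \<open>E\<close> sees some kernel of size at least
    \<open>1 / (4 * l)\<close>, so this factor lifts \<open>Re (H z)\<close> to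
    \<open>1 / \<delta>\<close> there.\<close>
  define H where "H = (\<lambda>z. of_real (4 / \<delta> * l) * (\<Sum>w\<in>W. h w z))"
  have small: "cmod (of_real r * cnj w * z) < 1" if "w \<in> W" "cmod z < 1 / r" for w z
  proof -
    have "cmod w = 1" using that W by auto
    then show ?thesis using that r by (simp add: norm_mult field_simps)
  qed
  have nz: "1 - of_real r * cnj w * z \<noteq> 0" if "w \<in> W" "cmod z < 1 / r" for w z
    using small[OF that] by auto
  have Re_h: "Re (h w z) = (1 - (cmod (of_real r * cnj w * z))\<^sup>2) / (cmod (1 - of_real r * cnj w * z))\<^sup>2" for w z
    unfolding h_def by (rule Re_moebius)
  have Re_h_pos: "0 \<le> Re (h w z)" if "w \<in> W" "cmod z < 1 / r" for w z
    unfolding Re_h using small[OF that] by (intro divide_nonneg_nonneg) (auto simp: power_le_one)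
  have Re_H: "Re (H z) = 4 / \<delta> * l * (\<Sum>w\<in>W. Re (h w z))" for z
    by (simp add: H_def del: of_real_mult of_real_divide)
  have Re_H_pos: "0 \<le> Re (H z)" if "cmod z < 1 / r" for z
    unfolding Re_H using Re_h_pos that l d by (intro mult_nonneg_nonneg sum_nonneg) auto
  have Re_H_E: "1 / \<delta> \<le> Re (H z)" if z: "z \<in> E" for z
  proof -
    obtain w where w: "w \<in> W" "cmod (z - w) \<le> l" using cov z by blast
    have n: "cmod z = 1" "cmod w = 1" using w W z E by auto
    have zr: "cmod z < 1 / r" using n r by simp
    \<comment> \<open>Since \<open>cnj w * w = 1\<close>, the denominator splits into
      \<open>1 - r = l\<close> and a term of modulus at most \<open>l\<close>.\<close>
    have "1 - of_real r * cnj w * z = of_real l + of_real r * (cnj w * (w - z))"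
      using n by (simp add: r_def algebra_simps complex_norm_square[symmetric])
    then have "cmod (1 - of_real r * cnj w * z) \<le> cmod (of_real l) + cmod (of_real r * (cnj w * (w - z)))"
      by (metis norm_triangle_ineq)
    also have "\<dots> = l + r * cmod (z - w)"
      using r l n by (simp add: norm_mult norm_minus_commute)
    also have "\<dots> \<le> l + 1 * l"
      using w r by (intro add_left_mono mult_mono) auto
    finally have "(cmod (1 - of_real r * cnj w * z))\<^sup>2 \<le> (2 * l)\<^sup>2" by (intro power_mono) auto
    moreover have "l \<le> 1 - r\<^sup>2" using l unfolding r_def power2_eq_square
      by (simp add: algebra_simps mult_le_cancel_left1)
    moreover have "0 < (cmod (1 - of_real r * cnj w * z))\<^sup>2" using nz[OF w(1) zr] by simp
    ultimately have "l / (2 * l)\<^sup>2 \<le> (1 - r\<^sup>2) / (cmod (1 - of_real r * cnj w * z))\<^sup>2"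
      using l by (intro frac_le) auto
    also have "\<dots> = Re (h w z)" unfolding Re_h using n r by (simp add: norm_mult)
    also have "\<dots> \<le> (\<Sum>w\<in>W. Re (h w z))"
      using W(1) w(1) Re_h_pos zr by (intro member_le_sum) auto
    finally have "4 / \<delta> * l * (l / (2 * l)\<^sup>2) \<le> Re (H z)"
      unfolding Re_H using l d by (intro mult_left_mono) auto
    moreover have "4 / \<delta> * l * (l / (2 * l)\<^sup>2) = 1 / \<delta>"
      using l by (simp add: power2_eq_square)
    ultimately show ?thesis by simp
  qed
  have H0: "H 0 = of_real (4 / \<delta> * (card W * l))" by (simp add: H_def h_def)
  have H0_le: "cmod (H 0) \<le> \<delta>"
  proof -
    have "cmod (H 0) = 4 / \<delta> * (card W * l)" unfolding H0 norm_of_real using d l by simp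
    also have "\<dots> \<le> 4 / \<delta> * (\<delta>\<^sup>2 / 4)" using card d by (intro mult_left_mono) auto
    also have "\<dots> = \<delta>" using d by (simp add: power2_eq_square)
    finally show ?thesis .
  qed
  have ge1: "1 + Re (H z) \<le> cmod (1 + H z)" for z
    using complex_Re_le_cmod[of "1 + H z"] by simp
  have nz1: "1 + H z \<noteq> 0" if "cmod z < 1 / r" for z
    using ge1[of z] Re_H_pos[OF that] by auto
  have one_minus: "1 - H z / (1 + H z) = 1 / (1 + H z)" if "cmod z < 1 / r" for z
    using nz1[OF that] by (simp add: field_simps)
  show ?thesis
  proof
    show "1 / r > 1" using r by simp
    have "H holomorphic_on ball 0 (1 / r)"
      unfolding H_def h_def by (intro holomorphic_intros) (use nz in auto)
    then show "(\<lambda>z. H z / (1 + H z)) holomorphic_on ball 0 (1 / r)"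
      by (intro holomorphic_intros) (use nz1 in auto)
    show "(cmod (H z / (1 + H z)))\<^sup>2 \<le> Re (H z / (1 + H z))" if "cmod z < 1 / r" for z
    proof -
      \<comment> \<open>Over the common denominator |1 + H|^2 the claim reads |H|^2 <= Re H +
        |H|^2.\<close>
      have "Re (H z / (1 + H z)) = Re (H z * cnj (1 + H z)) / (cmod (1 + H z))\<^sup>2"
        by (simp add: Re_divide_Reals complex_div_cnj[of "H z"])
      also have "Re (H z * cnj (1 + H z)) = Re (H z) + (cmod (H z))\<^sup>2"
        unfolding cmod_power2 by (simp add: power2_eq_square algebra_simps)
      finally show ?thesis using Re_H_pos[OF that]
        by (auto simp: norm_divide power_divide intro!: divide_right_mono)
    qed
    show "cmod (1 - H z / (1 + H z)) \<le> \<delta>" if "z \<in> E" for z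
    proof -
      have z: "cmod z < 1 / r" using that E r by auto
      have "1 / \<delta> \<le> cmod (1 + H z)" using ge1[of z] Re_H_E[OF that] by linarith
      then have "1 / cmod (1 + H z) \<le> 1 / (1 / \<delta>)" using d nz1[OF z] by (intro divide_left_mono) auto
      then show ?thesis unfolding one_minus[OF z] by (simp add: norm_divide)
    qed
    have "cmod (H 0 / (1 + H 0)) \<le> cmod (H 0)"
      using ge1[of 0] Re_H_pos[of 0] r
      by (auto simp: norm_divide divide_le_eq mult_le_cancel_left1)
    with H0_le show "cmod (H 0 / (1 + H 0)) \<le> \<delta>" by linarith
  qed
qed

section \<open>Uniform approximation on null sets\<close>

text \<open>Holomorphy across the closed disc, on a radius that may depend on \<open>e\<close>, is
  what boundedness on the disc and Taylor truncation require later.\<close>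

definition disc_approximable :: "complex set \<Rightarrow> (complex \<Rightarrow> complex) \<Rightarrow> bool" where
  "disc_approximable E h \<longleftrightarrow>
     (\<forall>e>0. \<exists>R>1. \<exists>p. p holomorphic_on ball 0 R \<and> (\<forall>z\<in>E. cmod (p z - h z) < e))"

lemma disc_approximableD:
  assumes "disc_approximable E h" "e > 0"
  obtains R p where "R > 1" "p holomorphic_on ball 0 R" "\<And>z. z \<in> E \<Longrightarrow> cmod (p z - h z) < e"
  using assms unfolding disc_approximable_def by metis

lemma disc_approximable_holomorphic:
  assumes "h holomorphic_on ball 0 R" "R > 1"
  shows "disc_approximable E h"
  unfolding disc_approximable_def using assms by (metis cancel_comm_monoid_add_class.diff_cancel norm_zero)

lemma disc_approximable_add:
  assumes "disc_approximable E h" "disc_approximable E k"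
  shows "disc_approximable E (\<lambda>z. h z + k z)"
  unfolding disc_approximable_def
proof (intro allI impI)
  fix e :: real assume e: "e > 0"
  obtain R p where p: "R > 1" "p holomorphic_on ball 0 R" "\<And>z. z \<in> E \<Longrightarrow> cmod (p z - h z) < e/2"
    using disc_approximableD[OF assms(1), of "e/2"] e by (metis half_gt_zero)
  obtain S q where q: "S > 1" "q holomorphic_on ball 0 S" "\<And>z. z \<in> E \<Longrightarrow> cmod (q z - k z) < e/2"
    using disc_approximableD[OF assms(2), of "e/2"] e by (metis half_gt_zero)
  have "(\<lambda>z. p z + q z) holomorphic_on ball 0 (min R S)"
    by (intro holomorphic_intros holomorphic_on_subset[OF p(2)] holomorphic_on_subset[OF q(2)]) auto
  moreover have "cmod (p z + q z - (h z + k z)) < e" if "z \<in> E" for z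
    using norm_triangle_lt[of "p z - h z" "q z - k z" e] p(3)[OF that] q(3)[OF that]
    by (simp add: algebra_simps)
  ultimately show "\<exists>R>1. \<exists>p. p holomorphic_on ball 0 R \<and> (\<forall>z\<in>E. cmod (p z - (h z + k z)) < e)"
    using p(1) q(1) by (intro exI[of _ "min R S"] conjI exI[of _ "\<lambda>z. p z + q z"]) auto
qed

lemma disc_approximable_mult:
  assumes "disc_approximable E h" "disc_approximable E k"
    and bdd: "bounded (h ` E)" "bounded (k ` E)"
  shows "disc_approximable E (\<lambda>z. h z * k z)"
  unfolding disc_approximable_def
proof (intro allI impI)
  fix e :: real assume e: "e > 0"
  obtain B where B: "B > 0" "\<And>z. z \<in> E \<Longrightarrow> cmod (h z) \<le> B"
    using bdd(1) by (auto simp: bounded_pos)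
  obtain C where C: "C > 0" "\<And>z. z \<in> E \<Longrightarrow> cmod (k z) \<le> C"
    using bdd(2) by (auto simp: bounded_pos)
  \<comment> \<open>The error is p (q - k) + (p - h) k. The second term fixes \<open>d\<close>; the
    tolerance \<open>d'\<close> for the first comes after it because |p| is bounded only by
    \<open>B + d\<close>. Each term costs at most \<open>e / 2\<close>.\<close>
  define d where "d = e / (2 * C)"
  have d: "d > 0" using e C by (simp add: d_def)
  define d' where "d' = e / (2 * (B + d))"
  have d': "d' > 0" using e B d by (simp add: d'_def)
  obtain R p where p: "R > 1" "p holomorphic_on ball 0 R" "\<And>z. z \<in> E \<Longrightarrow> cmod (p z - h z) < d"
    using disc_approximableD[OF assms(1) d] by metis
  obtain S q where q: "S > 1" "q holomorphic_on ball 0 S" "\<And>z. z \<in> E \<Longrightarrow> cmod (q z - k z) < d'"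
    using disc_approximableD[OF assms(2) d'] by metis
  have "(\<lambda>z. p z * q z) holomorphic_on ball 0 (min R S)"
    by (intro holomorphic_intros holomorphic_on_subset[OF p(2)] holomorphic_on_subset[OF q(2)]) auto
  moreover have "cmod (p z * q z - h z * k z) < e" if "z \<in> E" for z
  proof -
    have "cmod (p z) \<le> cmod (p z - h z) + cmod (h z)" by (metis diff_add_cancel norm_triangle_ineq)
    then have pz: "cmod (p z) \<le> B + d" using p(3)[OF that] B(2)[OF that] by linarith
    have "p z * q z - h z * k z = p z * (q z - k z) + (p z - h z) * k z" by (simp add: algebra_simps)
    then have "cmod (p z * q z - h z * k z) \<le> cmod (p z) * cmod (q z - k z) + cmod (p z - h z) * cmod (k z)"
      by (metis norm_mult norm_triangle_ineq)
    also have "cmod (p z) * cmod (q z - k z) \<le> (B + d) * cmod (q z - k z)"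
      using pz by (intro mult_right_mono) auto
    also have "\<dots> < (B + d) * d'"
      using q(3)[OF that] B d by (intro mult_strict_left_mono) auto
    also have "\<dots> = e / 2" using B(1) d by (simp add: d'_def divide_eq_eq)
    also have "cmod (p z - h z) * cmod (k z) \<le> d * C"
      using p(3)[OF that] C(2)[OF that] d by (intro mult_mono) auto
    also have "d * C = e / 2" using C by (simp add: d_def)
    finally show ?thesis by simp
  qed
  ultimately show "\<exists>R>1. \<exists>p. p holomorphic_on ball 0 R \<and> (\<forall>z\<in>E. cmod (p z - h z * k z) < e)"
    using p(1) q(1) by (intro exI[of _ "min R S"] conjI exI[of _ "\<lambda>z. p z * q z"]) auto
qed

text \<open>On the circle \<open>cnj z = 1 / z\<close>. Subtracting \<open>\<psi> 0\<close> makes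
  the singularity at 0 removable, with the derivative as value, and dividing by
  \<open>1 - \<psi> 0\<close> leaves on \<open>E\<close> exactly the error |1 - \<psi> z| / |1 -
  \<psi> 0|.\<close>

lemma disc_approximable_cnj:
  assumes E: "E \<subseteq> sphere 0 1" "closed E" "circle_null E"
  shows "disc_approximable E cnj"
  unfolding disc_approximable_def
proof (intro allI impI)
  fix e :: real assume e: "e > 0"
  \<comment> \<open>The bound 1/2 keeps \<open>1 - \<psi> 0\<close> away from 0, and
    \<open>e/4\<close> absorbs the factor 2 from dividing by it.\<close>
  define d where "d = min (1/2) (e/4)"
  have d: "d > 0" "d \<le> 1/2" "d \<le> e/4" using e by (auto simp: d_def)
  obtain R \<psi> where psi: "R > 1" "\<psi> holomorphic_on ball 0 R"
    "\<And>z. z \<in> E \<Longrightarrow> cmod (1 - \<psi> z) \<le> d" "cmod (\<psi> 0) \<le> d"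
    using peak_function[OF E d(1)] by metis
  have "1 \<le> cmod (1 - \<psi> 0) + cmod (\<psi> 0)"
    by (metis diff_add_cancel norm_one norm_triangle_ineq)
  then have half: "cmod (1 - \<psi> 0) \<ge> 1/2" using psi(4) d by linarith
  define q where "q = (\<lambda>z. (if z = 0 then deriv \<psi> 0 else (\<psi> z - \<psi> 0) / (z - 0)) / (1 - \<psi> 0))"
  have "q holomorphic_on ball 0 R"
    unfolding q_def using half
    by (intro holomorphic_on_divide holomorphic_on_const pole_lemma_open[OF psi(2)]) auto
  moreover have "cmod (q z - cnj z) < e" if z: "z \<in> E" for z
  proof -
    have n: "cmod z = 1" using z E by auto
    then have z0: "z \<noteq> 0" by auto
    have c: "cnj z = 1 / z" using n z0 by (simp add: eq_divide_eq mult.commute complex_norm_square[symmetric])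
    have "1 - \<psi> 0 \<noteq> 0" using half by auto
    then have "q z - cnj z = - (1 - \<psi> z) / (z * (1 - \<psi> 0))"
      unfolding q_def c using z0 by (simp add: field_simps)
    then have "cmod (q z - cnj z) = cmod (1 - \<psi> z) / cmod (1 - \<psi> 0)"
      using n by (simp add: norm_divide norm_mult norm_minus_commute)
    also have "\<dots> \<le> d / (1/2)"
      using half psi(3)[OF z] d by (intro frac_le) auto
    also have "\<dots> < e" using d e by simp
    finally show ?thesis .
  qed
  ultimately show "\<exists>R>1. \<exists>p. p holomorphic_on ball 0 R \<and> (\<forall>z\<in>E. cmod (p z - cnj z) < e)"
    using psi(1) by blast
qed

lemma compact_if_closed_subset_sphere:
  fixes E :: "complex set"
  assumes "E \<subseteq> sphere 0 1" "closed E"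
  shows "compact E"
  using assms by (metis compact_Int_closed compact_sphere inf.absorb_iff2)

lemma bounded_image_real_polynomial_function:
  fixes k :: "complex \<Rightarrow> real"
  assumes "compact E" "real_polynomial_function k"
  shows "bounded ((\<lambda>z. complex_of_real (k z)) ` E)"
  using assms
  by (intro compact_imp_bounded compact_continuous_image continuous_on_of_real
      continuous_on_polymonial_function) (auto simp: real_polynomial_function_eq)

text \<open>Sums and products reduce everything to constants and real-linear functionals. The latter
  are combinations of \<open>z\<close> and \<open>cnj z\<close>, so conjugation is the only
  generator that is not already holomorphic.\<close>

lemma disc_approximable_real_polynomial_function:
  fixes h :: "complex \<Rightarrow> real"
  assumes E: "E \<subseteq> sphere 0 1" "closed E" "circle_null E" and h: "real_polynomial_function h"
  shows "disc_approximable E (\<lambda>z. of_real (h z))"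
  using h
proof induction
  case (linear f)
  interpret f: bounded_linear f by fact
  have const: "disc_approximable E (\<lambda>_. c)" for c
    by (rule disc_approximable_holomorphic[of _ 2]) auto
  have id: "disc_approximable E (\<lambda>z. z)"
    by (rule disc_approximable_holomorphic[of _ 2]) (auto intro: holomorphic_intros)
  have bE: "bounded E" using E(1) bounded_sphere bounded_subset by blast
  have bc: "bounded (cnj ` E)" using bE by (auto simp: bounded_iff)
  \<comment> \<open>The coefficients come from Re z = (z + cnj z) / 2 and Im z = (z - cnj z) / (2
    \<i>).\<close>
  define a b where "a = (f 1 - \<i> * f \<i>) / 2" and "b = (f 1 + \<i> * f \<i>) / 2"
  have "of_real (f z) = a * z + b * cnj z" for z
  proof -
    have "f z = f (Re z *\<^sub>R 1 + Im z *\<^sub>R \<i>)"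
      by (rule arg_cong[where f = f]) (simp add: complex_eq_iff)
    then have "f z = Re z * f 1 + Im z * f \<i>"
      by (simp only: f.add f.scaleR real_scaleR_def)
    then show ?thesis unfolding a_def b_def by (simp add: complex_eq_iff field_simps)
  qed
  moreover have "disc_approximable E (\<lambda>z. a * z + b * cnj z)"
    by (intro disc_approximable_add disc_approximable_mult const id disc_approximable_cnj[OF E])
       (use bE bc in \<open>auto simp: image_constant_conv\<close>)
  ultimately show ?case by simp
next
  case (const c)
  show ?case by (rule disc_approximable_holomorphic[of _ 2]) auto
next
  case (add f g)
  then show ?case using disc_approximable_add by simp
next
  case (mult f g)
  have cE: "compact E" using E(1,2) by (rule compact_if_closed_subset_sphere)
  show ?case
    using disc_approximable_mult[OF mult.IH] mult.hyps[THEN bounded_image_real_polynomial_function[OF cE]]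
    by simp
qed

text \<open>Stone-Weierstrass supplies a polynomial in the two real coordinates, whose real and
  imaginary parts are approximated separately.\<close>

lemma disc_approximable_continuous_on:
  assumes E: "E \<subseteq> sphere 0 1" "closed E" "circle_null E" and h: "continuous_on E h"
  shows "disc_approximable E h"
  unfolding disc_approximable_def
proof (intro allI impI)
  fix e :: real assume e: "e > 0"
  have cE: "compact E" using E(1,2) by (rule compact_if_closed_subset_sphere)
  obtain k where k: "polynomial_function k" "\<And>z. z \<in> E \<Longrightarrow> cmod (h z - k z) < e/2"
    using Stone_Weierstrass_polynomial_function[OF cE h, of "e/2"] e by auto
  have "real_polynomial_function (Re \<circ> k)" "real_polynomial_function (Im \<circ> k)"
    using k(1) bounded_linear_Re bounded_linear_Im unfolding polynomial_function_def by blast+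
  note ri = this[THEN disc_approximable_real_polynomial_function[OF E]]
  have "bounded ((\<lambda>z. complex_of_real ((Im \<circ> k) z)) ` E)"
    by (rule bounded_image_real_polynomial_function[OF cE \<open>real_polynomial_function (Im \<circ> k)\<close>])
  then have "disc_approximable E (\<lambda>z. of_real ((Re \<circ> k) z) + \<i> * of_real ((Im \<circ> k) z))"
    by (intro disc_approximable_add disc_approximable_mult ri)
       (auto simp: image_constant_conv intro: disc_approximable_holomorphic[of _ 2])
  then have "disc_approximable E k" by (simp flip: complex_eq)
  then obtain R p where p: "R > 1" "p holomorphic_on ball 0 R" "\<And>z. z \<in> E \<Longrightarrow> cmod (p z - k z) < e/2"
    using disc_approximableD[of E k "e/2"] e by (metis half_gt_zero)
  have "cmod (p z - h z) < e" if "z \<in> E" for z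
    using norm_diff_triangle_less[OF p(3)[OF that], of "h z" "e/2"] k(2)[OF that]
    by (simp add: norm_minus_commute)
  with p show "\<exists>R>1. \<exists>p. p holomorphic_on ball 0 R \<and> (\<forall>z\<in>E. cmod (p z - h z) < e)" by blast
qed

section \<open>Simultaneous approximation\<close>

lemma circle_null_missing_point:
  assumes "circle_null E"
  obtains p where "cmod p = 1" "p \<notin> E"
proof (rule ccontr)
  assume "\<not> thesis"
  then have "{t \<in> {0..<2*pi}. cis t \<in> E} = {0..<2*pi}" using that[of "cis _"] by auto
  then have "emeasure lborel {0..<2*pi} = 0"
    using assms unfolding circle_null_def by (metis null_setsD1)
  then show False by simp
qed

text \<open>The closed disc without \<open>E\<close> lies between the open disc and its closure, and
  the complement of the open disc without \<open>E\<close> lies between the open exterior and its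
  closure, so both are connected. A circle point outside \<open>E\<close> joins them.\<close>

lemma connected_Compl_circle_null:
  assumes E: "E \<subseteq> sphere 0 1" "circle_null E"
  shows "connected (- E)"
proof -
  obtain p where p: "cmod p = 1" "p \<notin> E" using circle_null_missing_point[OF E(2)] .
  have "connected (cball 0 1 - E)"
    by (rule connected_intermediate_closure[of "ball 0 1"]) (use E in auto)
  moreover have "connected (- ball 0 1 - E)"
  proof (rule connected_intermediate_closure[of "- cball 0 1"])
    show "connected (- cball 0 1 :: complex set)"
      by (rule connected_complement_bounded_convex) auto
    show "- cball 0 1 \<subseteq> - ball 0 1 - E" using E by auto
    show "- ball 0 1 - E \<subseteq> closure (- cball 0 1)" by (auto simp: closure_complement)
  qed
  moreover have "p \<in> (cball 0 1 - E) \<inter> (- ball 0 1 - E)" using p by auto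
  ultimately have "connected ((cball 0 1 - E) \<union> (- ball 0 1 - E))"
    by (intro connected_Un) blast+
  moreover have "(cball 0 1 - E) \<union> (- ball 0 1 - E) = - E" by auto
  ultimately show ?thesis by simp
qed

text \<open>A compact plane set with connected complement is Borsukian: continuous nonvanishing
  functions on it have continuous logarithms.\<close>

lemma circle_null_continuous_logarithm:
  assumes E: "E \<subseteq> sphere 0 1" "closed E" "circle_null E"
    and f: "continuous_on E f" "\<forall>z\<in>E. f z \<noteq> (0::complex)"
  obtains F where "continuous_on E F" "\<And>z. z \<in> E \<Longrightarrow> f z = exp (F z)"
proof -
  have "compact E" using E(1,2) by (rule compact_if_closed_subset_sphere)
  then have "Borsukian E"
    using connected_Compl_circle_null[OF E(1,3)] by (simp add: Borsukian_separation_compact)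
  moreover have "f \<in> E \<rightarrow> - {0}" using f by auto
  ultimately show ?thesis using f(1) that unfolding Borsukian_continuous_logarithm by metis
qed

section \<open>Estimates for exponentials, square sums, dilations and Taylor polynomials\<close>

text \<open>Mean value inequality on the disc of radius |w|. The factor |w| is kept so that at
  \<open>w = p z * \<psi> z\<close> the bound stays proportional to |\<psi>|.\<close>

lemma norm_exp_minus_one_le: "cmod (exp w - 1) \<le> cmod w * exp (cmod w)"
proof -
  have "cmod (exp w - exp 0) \<le> exp (cmod w) * cmod (w - 0)"
  proof (rule field_differentiable_bound[of "cball 0 (cmod w)" exp exp])
    show "cmod (exp z) \<le> exp (cmod w)" if "z \<in> cball 0 (cmod w)" for z
      using norm_exp[of z] that by (auto intro: order_trans)
  qed (auto intro: DERIV_exp has_field_derivative_at_within)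
  then show ?thesis by (simp add: mult.commute)
qed

text \<open>Working with squares, by (x + y)^2 <= 2 x^2 + 2 y^2, postpones the square root to the
  end. Summability is carried along so that the infinite sums can be compared.\<close>

lemma square_summable_triangle:
  fixes a b c :: "nat \<Rightarrow> complex"
  assumes "summable (\<lambda>k. (cmod (a k - b k))\<^sup>2)" "summable (\<lambda>k. (cmod (b k - c k))\<^sup>2)"
  shows "summable (\<lambda>k. (cmod (a k - c k))\<^sup>2)"
    and "(\<Sum>k. (cmod (a k - c k))\<^sup>2) \<le> 2 * (\<Sum>k. (cmod (a k - b k))\<^sup>2) + 2 * (\<Sum>k. (cmod (b k - c k))\<^sup>2)"
proof -
  have le: "(cmod (a k - c k))\<^sup>2 \<le> 2 * (cmod (a k - b k))\<^sup>2 + 2 * (cmod (b k - c k))\<^sup>2" for k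
  proof -
    have "cmod (a k - c k) \<le> cmod (a k - b k) + cmod (b k - c k)"
      using norm_triangle_ineq[of "a k - b k" "b k - c k"] by simp
    then have "(cmod (a k - c k))\<^sup>2 \<le> (cmod (a k - b k) + cmod (b k - c k))\<^sup>2"
      by (intro power_mono) auto
    also have "\<dots> \<le> 2 * (cmod (a k - b k))\<^sup>2 + 2 * (cmod (b k - c k))\<^sup>2"
      using zero_le_power2[of "cmod (a k - b k) - cmod (b k - c k)"]
      by (simp add: power2_eq_square algebra_simps)
    finally show ?thesis .
  qed
  have s: "summable (\<lambda>k. 2 * (cmod (a k - b k))\<^sup>2 + 2 * (cmod (b k - c k))\<^sup>2)"
    using assms by (intro summable_add summable_mult)
  show sm: "summable (\<lambda>k. (cmod (a k - c k))\<^sup>2)"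
    by (rule summable_comparison_test'[OF s, of 0]) (use le in auto)
  have "(\<Sum>k. (cmod (a k - c k))\<^sup>2) \<le> (\<Sum>k. 2 * (cmod (a k - b k))\<^sup>2 + 2 * (cmod (b k - c k))\<^sup>2)"
    using le sm s by (intro suminf_le)
  also have "\<dots> = 2 * (\<Sum>k. (cmod (a k - b k))\<^sup>2) + 2 * (\<Sum>k. (cmod (b k - c k))\<^sup>2)"
    using assms by (subst suminf_add[symmetric]) (auto simp: suminf_mult summable_mult)
  finally show "(\<Sum>k. (cmod (a k - c k))\<^sup>2) \<le>
      2 * (\<Sum>k. (cmod (a k - b k))\<^sup>2) + 2 * (\<Sum>k. (cmod (b k - c k))\<^sup>2)" .
qed

lemma h2_coeff_dilation:
  assumes "g holomorphic_on ball 0 1" "0 < r" "r < 1"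
  shows "h2_coeff (\<lambda>z. g (of_real r * z)) k = of_real r ^ k * h2_coeff g k"
proof -
  have "(deriv ^^ k) (\<lambda>w. g (of_real r * w)) 0 = of_real r ^ k * (deriv ^^ k) g (of_real r * 0)"
  proof (rule higher_deriv_compose_linear[OF assms(1), of "ball 0 1"])
    fix w :: complex assume "w \<in> ball 0 1"
    then have "r * cmod w < 1 * 1" using assms by (intro mult_strict_mono') auto
    then show "of_real r * w \<in> ball 0 1" using assms by (simp add: norm_mult)
  qed auto
  then show ?thesis by (simp add: h2_coeff_def)
qed

text \<open>Dilation multiplies the k-th coefficient by \<open>r ^ k\<close>, so the terms are (1 -
  r^k)^2 times the squared modulus of the coefficient of \<open>g\<close>. They tend to 0 as r tends
  to 1 and are dominated by a convergent series, so Tannery's theorem applies.\<close>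

lemma H2_dilation_approx:
  assumes g: "g \<in> H2" and e: "e > 0"
  obtains r where "0 < r" "r < 1"
    "summable (\<lambda>k. (cmod (h2_coeff (\<lambda>z. g (of_real r * z)) k - h2_coeff g k))\<^sup>2)"
    "(\<Sum>k. (cmod (h2_coeff (\<lambda>z. g (of_real r * z)) k - h2_coeff g k))\<^sup>2) < e"
proof -
  have hol: "g holomorphic_on ball 0 1" and sm: "summable (\<lambda>k. (cmod (h2_coeff g k))\<^sup>2)"
    using g by (auto simp: H2_def)
  \<comment> \<open>Two successors give \<open>r 0 = 1/2\<close>; a single one would give 0.\<close>
  define r :: "nat \<Rightarrow> real" where "r = (\<lambda>n. 1 - inverse (real (Suc (Suc n))))"
  have r: "0 < r n" "r n < 1" for n by (auto simp: r_def field_simps)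
  have "r \<longlonglongrightarrow> 1 - 0"
    unfolding r_def by (intro tendsto_diff tendsto_const LIMSEQ_Suc[OF LIMSEQ_inverse_real_of_nat])
  then have r1: "r \<longlonglongrightarrow> 1" by simp
  define a where "a = (\<lambda>k n. (cmod (h2_coeff (\<lambda>z. g (of_real (r n) * z)) k - h2_coeff g k))\<^sup>2)"
  have a: "a k n = (1 - r n ^ k)\<^sup>2 * (cmod (h2_coeff g k))\<^sup>2" for k n
  proof -
    have "h2_coeff (\<lambda>z. g (of_real (r n) * z)) k - h2_coeff g k =
        - (of_real (1 - r n ^ k) * h2_coeff g k)"
      using h2_coeff_dilation[OF hol r, of n k] by (simp add: algebra_simps)
    then show ?thesis unfolding a_def
      by (simp only: norm_minus_cancel norm_mult norm_of_real power_mult_distrib power2_abs)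
  qed
  have le: "norm (a k n) \<le> (cmod (h2_coeff g k))\<^sup>2" for k n
  proof -
    have "0 \<le> r n ^ k" "r n ^ k \<le> 1" using r[of n] by (auto intro: power_le_one less_imp_le)
    then have "(1 - r n ^ k)\<^sup>2 \<le> 1" by (intro power_le_one) auto
    then show ?thesis unfolding a by (simp add: abs_mult mult_left_le_one_le)
  qed
  have "(\<lambda>n. a k n) \<longlonglongrightarrow> (1 - 1 ^ k)\<^sup>2 * (cmod (h2_coeff g k))\<^sup>2" for k
    unfolding a by (intro tendsto_intros r1)
  then have "(\<lambda>n. a k n) \<longlonglongrightarrow> 0" for k by simp
  from tannerys_theorem[OF this always_eventually sm]
  have "(\<lambda>n. \<Sum>k. a k n) \<longlonglongrightarrow> 0" and "eventually (\<lambda>n. summable (\<lambda>k. norm (a k n))) sequentially"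
    using le by auto
  then have "eventually (\<lambda>n. (\<Sum>k. a k n) < e \<and> summable (\<lambda>k. norm (a k n))) sequentially"
    using e by (intro eventually_conj order_tendstoD(2))
  then obtain n where "(\<Sum>k. a k n) < e" "summable (\<lambda>k. norm (a k n))"
    using eventually_happens[of _ sequentially] by auto
  then show ?thesis using that[OF r[of n]] unfolding a_def by simp
qed

lemma holomorphic_bounded_cball:
  fixes p :: "complex \<Rightarrow> complex"
  assumes "p holomorphic_on ball 0 R" "R > 1"
  obtains B where "B > 0" "\<And>z. cmod z \<le> 1 \<Longrightarrow> cmod (p z) \<le> B"
proof -
  have "continuous_on (cball 0 1) p"
    by (rule continuous_on_subset[OF holomorphic_on_imp_continuous_on[OF assms(1)]])
       (use assms in auto)
  then have "bounded (p ` cball 0 1)"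
    by (intro compact_imp_bounded compact_continuous_image) auto
  then show ?thesis using that by (auto simp: bounded_pos)
qed

text \<open>On the closed disc |\<Phi>| >= 1/B by compactness, so a Taylor polynomial within less
  than 1/B of \<Phi> cannot vanish there.\<close>

lemma zero_free_poly_approx:
  assumes Phi: "\<Phi> holomorphic_on ball 0 R" "R > 1" "\<And>z. cmod z \<le> 1 \<Longrightarrow> \<Phi> z \<noteq> 0" and t: "\<tau> > 0"
  obtains P where "\<And>z. cmod z \<le> 1 \<Longrightarrow> poly P z \<noteq> 0"
    "\<And>z. cmod z \<le> 1 \<Longrightarrow> cmod (poly P z - \<Phi> z) < \<tau>"
proof -
  have "(\<lambda>z. 1 / \<Phi> z) holomorphic_on cball 0 1"
    by (intro holomorphic_intros holomorphic_on_subset[OF Phi(1)]) (use Phi in auto)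
  then have "bounded ((\<lambda>z. 1 / \<Phi> z) ` cball 0 1)"
    by (intro compact_imp_bounded compact_continuous_image holomorphic_on_imp_continuous_on) auto
  then obtain B where B: "B > 0" "\<And>z. cmod z \<le> 1 \<Longrightarrow> cmod (1 / \<Phi> z) \<le> B"
    by (auto simp: bounded_pos)
  have low: "1 / B \<le> cmod (\<Phi> z)" if "cmod z \<le> 1" for z
    using B(2)[OF that] B(1) Phi(3)[OF that] by (simp add: norm_divide field_simps)
  have "min \<tau> (1 / B) > 0" using t B by simp
  from uniform_limitD[OF uniform_limit_taylor_poly[OF Phi(1,2)] this]
  obtain n where "\<forall>z\<in>cball 0 1. dist (poly (taylor_poly \<Phi> n) z) (\<Phi> z) < min \<tau> (1 / B)"
    using eventually_happens sequentially_bot by blast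
  then have n: "dist (poly (taylor_poly \<Phi> n) z) (\<Phi> z) < min \<tau> (1 / B)" if "cmod z \<le> 1" for z
    using that by simp
  show ?thesis
  proof
    fix z :: complex assume z: "cmod z \<le> 1"
    show "cmod (poly (taylor_poly \<Phi> n) z - \<Phi> z) < \<tau>" using n[OF z] by (simp add: dist_norm)
    show "poly (taylor_poly \<Phi> n) z \<noteq> 0" using n[OF z] low[OF z] by (auto simp: dist_norm)
  qed
qed

section \<open>One polynomial for both approximations\<close>

lemma zero_free_poly_simultaneous_approx:
  assumes E: "E \<subseteq> sphere 0 1" "closed E" "circle_null E"
    and g: "g \<in> H2" "\<forall>z\<in>ball 0 1. g z \<noteq> 0"
    and f: "continuous_on E f" "\<forall>z\<in>E. f z \<noteq> 0" and e: "e > 0"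
  obtains P where "\<And>z. cmod z \<le> 1 \<Longrightarrow> poly P z \<noteq> 0" "\<bar>h2_dist (poly P) g\<bar> < e"
    "\<And>z. z \<in> E \<Longrightarrow> cmod (poly P z - f z) < e"
proof -
  have cE: "compact E" using E(1,2) by (rule compact_if_closed_subset_sphere)
  have holg: "g holomorphic_on ball 0 1" using g by (auto simp: H2_def)
  \<comment> \<open>The squared distances from \<open>poly P\<close> to \<open>\<Phi>\<close>, from
    \<open>\<Phi>\<close> to \<open>gr\<close> and from \<open>gr\<close> to \<open>g\<close> are at
    most \<open>s\<close> each. Two uses of the squared triangle inequality give at most 4s + 4s +
    2s = 10s, below e^2 = 16s.\<close>
  define s where "s = e\<^sup>2 / 16"
  have s: "s > 0" using e by (simp add: s_def)
  obtain r where r: "0 < r" "r < 1"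
    and r_sum: "summable (\<lambda>k. (cmod (h2_coeff (\<lambda>z. g (of_real r * z)) k - h2_coeff g k))\<^sup>2)"
    and r_le: "(\<Sum>k. (cmod (h2_coeff (\<lambda>z. g (of_real r * z)) k - h2_coeff g k))\<^sup>2) < s"
    by (rule H2_dilation_approx[OF g(1) s]) (rule that)
  define gr where "gr = (\<lambda>z. g (of_real r * z))"
  have r1: "1 < 1 / r" using r by simp
  have mem: "of_real r * z \<in> ball 0 1" if "z \<in> ball 0 (1 / r)" for z :: complex
    using that r by (simp add: norm_mult field_simps)
  have hol_gr: "gr holomorphic_on ball 0 (1 / r)"
    unfolding gr_def
    by (rule holomorphic_on_compose_gen[OF _ holg, unfolded o_def])
       (use mem in \<open>auto intro!: holomorphic_intros\<close>)
  have gr_nz: "gr z \<noteq> 0" if "z \<in> ball 0 (1 / r)" for z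
    using g(2) mem[OF that] by (auto simp: gr_def)
  obtain G where G: "G holomorphic_on ball 0 (1 / r)" "\<And>z. z \<in> ball 0 (1 / r) \<Longrightarrow> gr z = exp (G z)"
    using contractible_imp_holomorphic_log[OF hol_gr convex_imp_contractible[OF convex_ball] gr_nz]
    by metis
  obtain C where C: "C > 0" "\<And>z. cmod z \<le> 1 \<Longrightarrow> cmod (G z) \<le> C"
    using holomorphic_bounded_cball[OF G(1) r1] by metis
  obtain F where F: "continuous_on E F" "\<And>z. z \<in> E \<Longrightarrow> f z = exp (F z)"
    using circle_null_continuous_logarithm[OF E f] by metis
  have "bounded (f ` E)" using cE f(1) by (intro compact_imp_bounded compact_continuous_image)
  then obtain M where M: "M > 0" "\<And>z. z \<in> E \<Longrightarrow> cmod (f z) \<le> M" by (auto simp: bounded_pos)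
  \<comment> \<open>An exponent error \<open>w\<close> with |w| <= \<theta> <= 1 changes the factor
    \<open>exp w\<close> by at most 3 \<theta>; with |f| <= M the error on \<open>E\<close> is at
    most 3 M \<theta> <= e/2.\<close>
  define \<theta> where "\<theta> = min 1 (e / (6 * M))"
  have th: "\<theta> > 0" "\<theta> \<le> 1" "M * (\<theta> * 3) \<le> e / 2"
  proof -
    have "\<theta> \<le> e / (6 * M)" by (simp add: \<theta>_def)
    then show "M * (\<theta> * 3) \<le> e / 2" using M(1) by (simp add: field_simps)
  qed (use e M(1) in \<open>auto simp: \<theta>_def\<close>)
  have "continuous_on E G"
    by (rule continuous_on_subset[OF holomorphic_on_imp_continuous_on[OF G(1)]])
       (use E(1) r1 in auto)
  then have "continuous_on E (\<lambda>z. F z - G z)" using F(1) by (intro continuous_intros)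
  from disc_approximableD[OF disc_approximable_continuous_on[OF E this], of "\<theta> / 2"] th(1)
  obtain R p where R: "R > 1" and p: "p holomorphic_on ball 0 R"
    and p_approx: "\<And>z. z \<in> E \<Longrightarrow> cmod (p z - (F z - G z)) < \<theta> / 2"
    by (metis half_gt_zero)
  obtain B where B: "B > 0" "\<And>z. cmod z \<le> 1 \<Longrightarrow> cmod (p z) \<le> B"
    using holomorphic_bounded_cball[OF p R] by metis
  \<comment> \<open>Since |G| <= C and |p| <= B, the difference exp G (exp (p \<psi>) - 1) is at
    most K |\<psi>| on the circle.\<close>
  define K where "K = exp C * (B * exp B)"
  have K: "K > 0" using B by (simp add: K_def)
  \<comment> \<open>The first bound controls p (1 - \<psi>) on \<open>E\<close>; the second makes
    the mean square bound K^2 Re \<psi>(0) at most \<open>s\<close>.\<close>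
  define \<delta> where "\<delta> = min (\<theta> / (2 * B)) (s / K\<^sup>2)"
  have d: "\<delta> > 0" "B * \<delta> \<le> \<theta> / 2" "K\<^sup>2 * \<delta> \<le> s"
  proof -
    show "\<delta> > 0" using th B s K by (simp add: \<delta>_def)
    have "\<delta> \<le> \<theta> / (2 * B)" "\<delta> \<le> s / K\<^sup>2" by (auto simp: \<delta>_def)
    then show "B * \<delta> \<le> \<theta> / 2" "K\<^sup>2 * \<delta> \<le> s" using B(1) K by (auto simp: field_simps)
  qed
  obtain R' \<psi> where R': "R' > 1" and psi: "\<psi> holomorphic_on ball 0 R'"
    and psi_Re: "\<And>z. cmod z < R' \<Longrightarrow> (cmod (\<psi> z))\<^sup>2 \<le> Re (\<psi> z)"
    and psi_E: "\<And>z. z \<in> E \<Longrightarrow> cmod (1 - \<psi> z) \<le> \<delta>" and psi_0: "cmod (\<psi> 0) \<le> \<delta>"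
    using peak_function[OF E d(1)] by metis
  \<comment> \<open>From |\<psi>|^2 <= Re \<psi> <= |\<psi>|.\<close>
  have psi_le: "cmod (\<psi> z) \<le> 1" if "cmod z \<le> 1" for z
  proof -
    have "(cmod (\<psi> z))\<^sup>2 \<le> cmod (\<psi> z)"
      using psi_Re[of z] complex_Re_le_cmod[of "\<psi> z"] that R' by linarith
    then have "cmod (\<psi> z) * (cmod (\<psi> z) - 1) \<le> 0"
      by (simp add: power2_eq_square algebra_simps)
    then show ?thesis by (auto simp: mult_le_0_iff)
  qed
  define S where "S = min (1 / r) (min R R')"
  have S: "S > 1" using r1 R R' by (simp add: S_def)
  have hol: "G holomorphic_on ball 0 S" "p holomorphic_on ball 0 S" "\<psi> holomorphic_on ball 0 S"
    "gr holomorphic_on ball 0 S"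
    by (rule holomorphic_on_subset[OF G(1)] holomorphic_on_subset[OF p]
        holomorphic_on_subset[OF psi] holomorphic_on_subset[OF hol_gr]; auto simp: S_def)+
  define \<Phi> where "\<Phi> = (\<lambda>z. exp (G z + p z * \<psi> z))"
  have Phi: "\<Phi> holomorphic_on ball 0 S" unfolding \<Phi>_def by (intro holomorphic_intros hol)
  have Phi_E: "cmod (\<Phi> z - f z) \<le> e / 2" if z: "z \<in> E" for z
  proof -
    define w where "w = G z + p z * \<psi> z - F z"
    have n: "cmod z \<le> 1" using z E by auto
    \<comment> \<open>The exponent error splits into the error of \<open>p\<close> and the defect of
      the peak function, each at most \<theta>/2.\<close>
    have "w = (p z - (F z - G z)) - p z * (1 - \<psi> z)" by (simp add: w_def algebra_simps)
    then have "cmod w \<le> cmod (p z - (F z - G z)) + cmod (p z) * cmod (1 - \<psi> z)"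
      by (metis norm_mult norm_triangle_ineq4)
    also have "cmod (p z) * cmod (1 - \<psi> z) \<le> B * \<delta>"
      using B(2)[OF n] B(1) psi_E[OF z] by (intro mult_mono) auto
    finally have w: "cmod w \<le> \<theta>" using p_approx[OF z] d(2) by linarith
    have "exp (cmod w) \<le> exp 1" using w th(2) by simp
    then have e3: "exp (cmod w) \<le> 3" using exp_le by linarith
    have "\<Phi> z = f z * exp w" unfolding F(2)[OF z] \<Phi>_def w_def by (simp flip: exp_add)
    then have "cmod (\<Phi> z - f z) = cmod (f z) * cmod (exp w - 1)"
      by (simp add: right_diff_distrib flip: norm_mult)
    also have "\<dots> \<le> M * (cmod w * exp (cmod w))"
      using M z norm_exp_minus_one_le by (intro mult_mono) auto
    also have "\<dots> \<le> M * (\<theta> * 3)"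
      using M(1) w e3 th(1) by (intro mult_left_mono mult_mono) auto
    finally show ?thesis using th(3) by linarith
  qed
  have Phi_gr: "cmod (\<Phi> z - gr z) \<le> K * cmod (\<psi> z)" if z: "cmod z = 1" for z
  proof -
    have pp: "cmod (p z * \<psi> z) \<le> B * cmod (\<psi> z)"
      using B(2)[of z] z by (simp add: norm_mult mult_right_mono)
    also have "\<dots> \<le> B" using psi_le[of z] z B(1) by (simp add: mult_left_le)
    finally have pB: "cmod (p z * \<psi> z) \<le> B" .
    have "exp (cmod (G z)) \<le> exp C" using C(2)[of z] z by simp
    then have "cmod (exp (G z)) \<le> exp C" by (rule order_trans[OF norm_exp])
    moreover have "\<Phi> z - gr z = exp (G z) * (exp (p z * \<psi> z) - 1)"
      using G(2)[of z] z r1 by (simp add: \<Phi>_def exp_add algebra_simps)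
    moreover have "cmod (exp (p z * \<psi> z) - 1) \<le> (B * cmod (\<psi> z)) * exp B"
      by (rule order_trans[OF norm_exp_minus_one_le]) (use pp pB B(1) in \<open>auto intro!: mult_mono\<close>)
    ultimately have "cmod (\<Phi> z - gr z) \<le> exp C * ((B * cmod (\<psi> z)) * exp B)"
      by (simp only: norm_mult) (intro mult_mono, auto)
    then show ?thesis by (simp add: K_def mult_ac)
  qed
  have sum_Phi_gr: "summable (\<lambda>k. (cmod (h2_coeff \<Phi> k - h2_coeff gr k))\<^sup>2)"
    and le_Phi_gr: "(\<Sum>k. (cmod (h2_coeff \<Phi> k - h2_coeff gr k))\<^sup>2) \<le> s"
  proof -
    have hd: "(\<lambda>z. \<Phi> z - gr z) holomorphic_on ball 0 S" by (intro holomorphic_intros Phi hol)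
    have cd: "h2_coeff (\<lambda>z. \<Phi> z - gr z) k = h2_coeff \<Phi> k - h2_coeff gr k" for k
      using h2_coeff_diff[OF Phi hol(4)] S by simp
    show "summable (\<lambda>k. (cmod (h2_coeff \<Phi> k - h2_coeff gr k))\<^sup>2)"
      using parseval_cis(1)[OF hd S] by (simp add: cd)
    have "(\<Sum>k. (cmod (h2_coeff (\<lambda>z. \<Phi> z - gr z) k))\<^sup>2) \<le> K\<^sup>2 * Re (\<psi> 0)"
      by (rule suminf_h2_coeff_le[OF hd hol(3) S Phi_gr psi_Re]) (use R' in auto)
    also have "\<dots> \<le> K\<^sup>2 * \<delta>"
      using psi_0 complex_Re_le_cmod[of "\<psi> 0"] by (intro mult_left_mono) auto
    finally show "(\<Sum>k. (cmod (h2_coeff \<Phi> k - h2_coeff gr k))\<^sup>2) \<le> s"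
      using d(3) by (simp add: cd)
  qed
  obtain P where P_nz: "\<And>z. cmod z \<le> 1 \<Longrightarrow> poly P z \<noteq> 0"
    and P: "\<And>z. cmod z \<le> 1 \<Longrightarrow> cmod (poly P z - \<Phi> z) < e / 4"
  proof (rule zero_free_poly_approx[OF Phi S, of "e / 4"])
    show "\<Phi> z \<noteq> 0" for z by (simp add: \<Phi>_def)
  qed (use e in auto)
  have sum_P_Phi: "summable (\<lambda>k. (cmod (h2_coeff (poly P) k - h2_coeff \<Phi> k))\<^sup>2)"
    and le_P_Phi: "(\<Sum>k. (cmod (h2_coeff (poly P) k - h2_coeff \<Phi> k))\<^sup>2) \<le> s"
  proof -
    have hP: "poly P holomorphic_on ball 0 S"
      by (auto simp: holomorphic_on_def field_differentiable_def
          intro: has_field_derivative_at_within poly_DERIV)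
    have hd: "(\<lambda>z. poly P z - \<Phi> z) holomorphic_on ball 0 S" by (intro holomorphic_on_diff hP Phi)
    have cd: "h2_coeff (\<lambda>z. poly P z - \<Phi> z) k = h2_coeff (poly P) k - h2_coeff \<Phi> k" for k
      using h2_coeff_diff[OF hP Phi] S by simp
    show "summable (\<lambda>k. (cmod (h2_coeff (poly P) k - h2_coeff \<Phi> k))\<^sup>2)"
      using parseval_cis(1)[OF hd S] by (simp add: cd)
    \<comment> \<open>The constant function 1 serves as \<open>\<psi>\<close>, so the sup bound e/4
      becomes the mean square bound (e/4)^2 = s.\<close>
    have "(\<Sum>k. (cmod (h2_coeff (\<lambda>z. poly P z - \<Phi> z) k))\<^sup>2) \<le> (e / 4)\<^sup>2 * Re ((\<lambda>_. 1) (0::complex))"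
      by (rule suminf_h2_coeff_le[OF hd holomorphic_on_const S]) (use P in \<open>auto intro: less_imp_le\<close>)
    then show "(\<Sum>k. (cmod (h2_coeff (poly P) k - h2_coeff \<Phi> k))\<^sup>2) \<le> s"
      by (simp add: cd s_def power_divide)
  qed
  note t1 = square_summable_triangle[OF sum_P_Phi sum_Phi_gr]
  note t2 = square_summable_triangle[OF t1(1) r_sum[folded gr_def]]
  have "(\<Sum>k. (cmod (h2_coeff (poly P) k - h2_coeff g k))\<^sup>2) < e\<^sup>2"
    using t1(2) t2(2) le_P_Phi le_Phi_gr r_le[folded gr_def] s s_def by linarith
  then have "sqrt (\<Sum>k. (cmod (h2_coeff (poly P) k - h2_coeff g k))\<^sup>2) < e"
    using e by (intro real_less_lsqrt) auto
  moreover have "0 \<le> (\<Sum>k. (cmod (h2_coeff (poly P) k - h2_coeff g k))\<^sup>2)"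
    by (rule suminf_nonneg[OF t2(1)]) simp
  ultimately have "\<bar>h2_dist (poly P) g\<bar> < e" by (simp add: h2_dist_def)
  moreover have "cmod (poly P z - f z) < e" if z: "z \<in> E" for z
  proof -
    have "cmod z \<le> 1" using z E by auto
    from P[OF this] Phi_E[OF z] show ?thesis
      using norm_triangle_ineq[of "poly P z - \<Phi> z" "\<Phi> z - f z"] e by simp
  qed
  ultimately show ?thesis using that P_nz by blast
qed

theorem theorem1p2:
  fixes E :: "complex set" and g f :: "complex \<Rightarrow> complex"
  assumes "E \<subseteq> sphere 0 1" and "closed E" and "circle_null E"
    and "g \<in> H2" and "\<forall>z\<in>ball 0 1. g z \<noteq> 0"
    and "continuous_on E f" and "\<forall>z\<in>E. f z \<noteq> 0"
  shows "\<exists>P :: nat \<Rightarrow> complex poly.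
           (\<forall>n. \<forall>z\<in>cball 0 1. poly (P n) z \<noteq> 0) \<and>
           (\<lambda>n. h2_dist (poly (P n)) g) \<longlonglongrightarrow> 0 \<and>
           uniform_limit E (\<lambda>n z. poly (P n) z) f sequentially"
proof -
  \<comment> \<open>The common tolerance 1/(n+1) makes one choice of polynomial per \<open>n\<close>
    serve both limits.\<close>
  have "\<exists>P. (\<forall>z. cmod z \<le> 1 \<longrightarrow> poly P z \<noteq> 0) \<and> \<bar>h2_dist (poly P) g\<bar> < inverse (real (Suc n)) \<and>
      (\<forall>z\<in>E. cmod (poly P z - f z) < inverse (real (Suc n)))" for n
    using zero_free_poly_simultaneous_approx[OF assms, of "inverse (real (Suc n))"]
    by (metis inverse_positive_iff_positive of_nat_0_less_iff zero_less_Suc)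
  then obtain P where nz: "\<And>n z. cmod z \<le> 1 \<Longrightarrow> poly (P n) z \<noteq> 0"
    and dist: "\<And>n. \<bar>h2_dist (poly (P n)) g\<bar> < inverse (real (Suc n))"
    and unif: "\<And>n z. z \<in> E \<Longrightarrow> cmod (poly (P n) z - f z) < inverse (real (Suc n))"
    by metis
  have "(\<lambda>n. h2_dist (poly (P n)) g) \<longlonglongrightarrow> 0"
    using dist by (intro Lim_null_comparison[OF _ LIMSEQ_inverse_real_of_nat] always_eventually)
      (auto intro: less_imp_le)
  moreover have "uniform_limit E (\<lambda>n z. poly (P n) z) f sequentially"
  proof (rule uniform_limitI)
    fix e :: real assume "e > 0"
    with LIMSEQ_inverse_real_of_nat
    have "eventually (\<lambda>n. inverse (real (Suc n)) < e) sequentially" by (rule order_tendstoD)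
    then show "\<forall>\<^sub>F n in sequentially. \<forall>z\<in>E. dist (poly (P n) z) (f z) < e"
      by eventually_elim (use unif in \<open>auto simp: dist_norm intro: less_trans\<close>)
  qed
  ultimately show ?thesis using nz by (intro exI[of _ P]) auto
qed

end
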